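(* Let $n\ge 3$ and let $d_s$ be a nonzero skew-symmetric derivation of $B_n^2$. Then there exists a scalar derivation $d_\alpha$ of $B_n^2$ such that the derivation $d=d_\alpha+d_s$ satisfies $\ker(d)=\mathbb{C}$.
   Context: $B_n^2=\mathbb{C}[X_1,\ldots,X_n]/(X_1^2+\cdots+X_n^2)$; $x_i$ denotes the residue class of $X_i$. All derivations are $\mathbb{C}$-derivations. A derivation $d$ of $B_n^2$ is called linear if there are $a_{ij}\in\mathbb{C}$ with $d(x_i)=\sum_{j=1}^n a_{ij}x_j$ for $i=1,\ldots,n$; the matrix $[d]=[a_{ij}]$ is the associated matrix of $d$. A scalar derivation $d_\alpha$ is a linear derivation whose associated matrix is a scalar matrix, i.e. $d_\alpha(x_i)=\alpha x_i$ for all $i$, for some $\alpha\in\mathbb{C}$. A skew-symmetric derivation is a linear derivation whose associated matrix $A$ satisfies $A^T=-A$. The ring of constants of $d$ is $\ker(d)=\{r\in B_n^2\mid d(r)=0\}$. *)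

theory Defs
  imports "HOL-Analysis.Analysis" "HOL-Library.Poly_Mapping"
begin

text \<open>
  Polynomials over the complex numbers in the variables \<open>X\<^sub>i\<close>, \<open>i :: 'n\<close>, are finitely supported
  functions from exponent vectors to coefficients.  The index type \<open>'n\<close> has \<open>n = CARD('n)\<close> elements.
\<close>

type_synonym 'n cpoly = "('n \<Rightarrow>\<^sub>0 nat) \<Rightarrow>\<^sub>0 complex"

definition pvar :: "'n \<Rightarrow> 'n cpoly" where
  "pvar i = Poly_Mapping.single (Poly_Mapping.single i 1) 1"

definition pconst :: "complex \<Rightarrow> 'n cpoly" where
  "pconst c = Poly_Mapping.single 0 c"

definition sum_squares :: "'n::finite cpoly" where
  "sum_squares = (\<Sum>i\<in>UNIV. pvar i ^ 2)"

text \<open>Congruence modulo the principal ideal generated by \<^term>\<open>sum_squares\<close>.\<close>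

definition fermat_rel :: "'n::finite cpoly \<Rightarrow> 'n cpoly \<Rightarrow> bool" where
  "fermat_rel p q \<longleftrightarrow> sum_squares dvd (p - q)"

lemma equivp_fermat_rel: "equivp (fermat_rel :: 'n::finite cpoly \<Rightarrow> _)"
proof (rule equivpI)
  show "reflp (fermat_rel :: 'n cpoly \<Rightarrow> _)"
    by (auto simp: reflp_def fermat_rel_def)
  show "symp (fermat_rel :: 'n cpoly \<Rightarrow> _)"
    unfolding symp_def fermat_rel_def
  proof (intro allI impI)
    fix p q :: "'n cpoly"
    assume "sum_squares dvd p - q"
    then have "sum_squares dvd - (p - q)" by (simp only: dvd_minus_iff)
    then show "sum_squares dvd q - p" by simp
  qed
  show "transp (fermat_rel :: 'n cpoly \<Rightarrow> _)"
    unfolding transp_def fermat_rel_def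
  proof (intro allI impI)
    fix p q r :: "'n cpoly"
    assume "sum_squares dvd p - q" "sum_squares dvd q - r"
    then have "sum_squares dvd (p - q) + (q - r)" by (rule dvd_add)
    then show "sum_squares dvd p - r" by simp
  qed
qed

lemma lookup_times_zero:
  fixes p q :: "'n cpoly"
  shows "Poly_Mapping.lookup (p * q) 0 = Poly_Mapping.lookup p 0 * Poly_Mapping.lookup q 0"
proof -
  have zero: "(0 :: 'n \<Rightarrow>\<^sub>0 nat) = a + b \<longleftrightarrow> a = 0 \<and> b = 0" for a b
    by (auto simp: poly_mapping_eq_iff fun_eq_iff lookup_add)
  have inner: "(\<Sum>b. Poly_Mapping.lookup q b when (0 :: 'n \<Rightarrow>\<^sub>0 nat) = a + b)
      = (Poly_Mapping.lookup q 0 when a = 0)" for a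
    unfolding zero by (cases "a = 0") simp_all
  show ?thesis
    unfolding lookup_mult inner by (simp add: mult_when)
qed

lemma not_sum_squares_dvd_one: "\<not> (sum_squares :: 'n::finite cpoly) dvd 1"
proof
  assume "(sum_squares :: 'n cpoly) dvd 1"
  then obtain q :: "'n cpoly" where q: "1 = sum_squares * q" by (auto simp: dvd_def)
  have "Poly_Mapping.lookup (sum_squares :: 'n cpoly) 0 = 0"
    by (simp add: sum_squares_def lookup_sum power2_eq_square lookup_times_zero pvar_def
        lookup_single when_def poly_mapping_eq_iff fun_eq_iff)
  with arg_cong[OF q, of "\<lambda>p. Poly_Mapping.lookup p 0"] show False
    by (simp add: lookup_times_zero lookup_one)
qed

text \<open>The ring \<open>B\<^sub>n\<^sup>2 = \<complex>[X\<^sub>1, \<dots>, X\<^sub>n] / (X\<^sub>1\<^sup>2 + \<dots> + X\<^sub>n\<^sup>2)\<close>.\<close>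

quotient_type (overloaded) 'n fermat2 = "'n::finite cpoly" / fermat_rel
  by (rule equivp_fermat_rel)

instantiation fermat2 :: (finite) comm_ring_1
begin

lift_definition zero_fermat2 :: "'a fermat2" is 0 .
lift_definition one_fermat2 :: "'a fermat2" is 1 .

lift_definition plus_fermat2 :: "'a fermat2 \<Rightarrow> 'a fermat2 \<Rightarrow> 'a fermat2" is "(+)"
  unfolding fermat_rel_def by (simp only: add_diff_add dvd_add)

lift_definition minus_fermat2 :: "'a fermat2 \<Rightarrow> 'a fermat2 \<Rightarrow> 'a fermat2" is "(-)"
proof -
  fix a b c d :: "'a cpoly"
  assume "fermat_rel a b" "fermat_rel c d"
  then have "sum_squares dvd ((a - b) - (c - d))"
    unfolding fermat_rel_def by (rule dvd_diff)
  then show "fermat_rel (a - c) (b - d)"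
    unfolding fermat_rel_def by (simp add: algebra_simps)
qed

lift_definition uminus_fermat2 :: "'a fermat2 \<Rightarrow> 'a fermat2" is uminus
  unfolding fermat_rel_def by (simp only: minus_diff_minus dvd_minus_iff)

lift_definition times_fermat2 :: "'a fermat2 \<Rightarrow> 'a fermat2 \<Rightarrow> 'a fermat2" is "(*)"
proof -
  fix a b c d :: "'a cpoly"
  assume "fermat_rel a b" "fermat_rel c d"
  then have "sum_squares dvd ((a - b) * c + b * (c - d))"
    unfolding fermat_rel_def by (intro dvd_add dvd_mult dvd_mult2)
  then show "fermat_rel (a * c) (b * d)"
    unfolding fermat_rel_def by (simp add: algebra_simps)
qed

instance
proof
  fix a b c :: "'a fermat2"
  show "a * b * c = a * (b * c)"
    by transfer (simp add: fermat_rel_def mult.assoc)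
  show "a * b = b * a"
    by transfer (simp add: fermat_rel_def mult.commute)
  show "1 * a = a"
    by transfer (simp add: fermat_rel_def)
  show "a + b + c = a + (b + c)"
    by transfer (simp add: fermat_rel_def add.assoc)
  show "a + b = b + a"
    by transfer (simp add: fermat_rel_def add.commute)
  show "0 + a = a"
    by transfer (simp add: fermat_rel_def)
  show "- a + a = 0"
    by transfer (simp add: fermat_rel_def)
  show "a - b = a + - b"
    by transfer (simp add: fermat_rel_def)
  show "(a + b) * c = a * c + b * c"
    by transfer (simp add: fermat_rel_def distrib_right)
  show "(0 :: 'a fermat2) \<noteq> 1"
    by transfer (simp add: fermat_rel_def not_sum_squares_dvd_one)
qed

end

text \<open>The residue class \<open>x\<^sub>i\<close> of \<open>X\<^sub>i\<close>, and the structure map of the complex algebra.\<close>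

lift_definition xvar :: "'n::finite \<Rightarrow> 'n fermat2" is pvar .

lift_definition cst :: "complex \<Rightarrow> 'n::finite fermat2" is pconst .

definition derivation :: "('n::finite fermat2 \<Rightarrow> 'n fermat2) \<Rightarrow> bool" where
  "derivation d \<longleftrightarrow>
     (\<forall>a b. d (a + b) = d a + d b) \<and>
     (\<forall>c a. d (cst c * a) = cst c * d a) \<and>
     (\<forall>a b. d (a * b) = d a * b + a * d b)"

definition associated_matrix ::
    "('n::finite fermat2 \<Rightarrow> 'n fermat2) \<Rightarrow> complex^'n^'n \<Rightarrow> bool" where
  "associated_matrix d A \<longleftrightarrow> (\<forall>i. d (xvar i) = (\<Sum>j\<in>UNIV. cst (A $ i $ j) * xvar j))"

definition linear_derivation :: "('n::finite fermat2 \<Rightarrow> 'n fermat2) \<Rightarrow> bool" where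
  "linear_derivation d \<longleftrightarrow> derivation d \<and> (\<exists>A. associated_matrix d A)"

definition scalar_derivation :: "('n::finite fermat2 \<Rightarrow> 'n fermat2) \<Rightarrow> bool" where
  "scalar_derivation d \<longleftrightarrow>
     linear_derivation d \<and> (\<exists>\<alpha>. associated_matrix d (mat \<alpha>))"

definition skew_symmetric_derivation :: "('n::finite fermat2 \<Rightarrow> 'n fermat2) \<Rightarrow> bool" where
  "skew_symmetric_derivation d \<longleftrightarrow>
     linear_derivation d \<and> (\<exists>A. associated_matrix d A \<and> transpose A = - A)"

definition ring_of_constants :: "('n::finite fermat2 \<Rightarrow> 'n fermat2) \<Rightarrow> 'n fermat2 set" where
  "ring_of_constants d = {r. d r = 0}"

end

theory Submission
  imports Defs
begin

text \<open>
  Let \<open>E\<close> be the Euler derivation of \<open>B\<^sub>n\<^sup>2\<close>, with \<open>E(x\<^sub>i) = x\<^sub>i\<close>; it exists because \<open>X\<^sub>1\<^sup>2 + \<dots> + X\<^sub>n\<^sup>2\<close>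
  is homogeneous.  Its eigenspace for the eigenvalue \<open>m\<close> is the space \<open>V\<^sub>m\<close> of forms of degree \<open>m\<close>,
  every element of the ring is a sum of forms, and \<open>V\<^sub>0 = \<complex>\<close>.  The scalar derivations are the
  multiples \<open>\<alpha>E\<close>.  A linear derivation \<open>d\<close> commutes with \<open>E\<close>, as the commutator is a derivation
  that kills all \<open>x\<^sub>i\<close>, so \<open>\<alpha>E + d\<close> preserves each \<open>V\<^sub>m\<close> and acts on it as \<open>\<alpha>m + d\<close>.  Thus
  \<open>\<alpha>E + d\<close> has a nonzero constant of degree \<open>m\<close> only if \<open>- \<alpha>m\<close> is an eigenvalue of \<open>d\<close>.

  The monomials form a countable spanning set, and eigenvectors for distinct eigenvalues are
  independent; hence \<open>d\<close> has only countably many eigenvalues.  As \<open>\<complex>\<close> is uncountable, some \<open>\<alpha>\<close>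
  avoids the numbers \<open>- \<mu> / m\<close> for all eigenvalues \<open>\<mu>\<close> of \<open>d\<close> and all \<open>m \<ge> 1\<close>.  For this \<open>\<alpha>\<close>
  the kernel of \<open>\<alpha>E + d\<close> has no component of positive degree, so it is \<open>V\<^sub>0 = \<complex>\<close>.
\<close>

section \<open>Eigenvalues in spaces of countable dimension\<close>

text \<open>
  Both the independence of eigenvectors and the uniqueness of the decomposition of a ring element
  into forms are instances of this.  Applying \<open>T - ev i\<close> to the relation removes the term at \<open>i\<close>
  and multiplies the others by nonzero scalars.
\<close>

lemma (in vector_space) eigenvectors_sum_zero:
  assumes "finite I" and "inj_on ev I"
    and add: "\<And>x y. T (x + y) = T x + T y"
    and scale: "\<And>c x. T (scale c x) = scale c (T x)"
    and "\<And>i. i \<in> I \<Longrightarrow> T (w i) = scale (ev i) (w i)"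
    and "sum w I = 0" and "i \<in> I"
  shows "w i = 0"
  using assms(1,2,5-)
proof (induction I arbitrary: w i rule: finite_induct)
  case empty
  then show ?case by simp
next
  case (insert k I)
  have T_0: "T 0 = 0"
    using scale[of 0 0] by simp
  have T_sum: "T (sum w J) = (\<Sum>j\<in>J. T (w j))" if "finite J" for J
    using that by induction (simp_all add: T_0 add)
  have sum_eq: "w k + sum w I = 0"
    using insert.prems insert.hyps by simp
  have "T (w k + sum w I) = 0"
    by (simp add: sum_eq T_0)
  then have "scale (ev k) (w k) + (\<Sum>j\<in>I. scale (ev j) (w j)) = 0"
    using insert.prems insert.hyps by (simp add: add T_sum)
  moreover have "scale (ev k) (w k) + (\<Sum>j\<in>I. scale (ev k) (w j)) = 0"
    by (metis sum_eq scale_right_distrib scale_sum_right scale_zero_right)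
  ultimately have "(\<Sum>j\<in>I. scale (ev j) (w j)) - (\<Sum>j\<in>I. scale (ev k) (w j)) = 0"
    by (metis add_left_cancel diff_self)
  then have "(\<Sum>j\<in>I. scale (ev j - ev k) (w j)) = 0"
    by (simp add: sum_subtractf scale_left_diff_distrib)
  then have "scale (ev j - ev k) (w j) = 0" if "j \<in> I" for j
    using that insert.prems insert.IH[of "\<lambda>j. scale (ev j - ev k) (w j)" j]
    by (simp add: scale scale_left_commute)
  moreover have "ev j \<noteq> ev k" if "j \<in> I" for j
    using that insert.prems(1) insert.hyps by (auto simp: inj_on_def)
  ultimately have "w j = 0" if "j \<in> I" for j
    using that by simp
  moreover from this have "w k = 0"
    using sum_eq by simp
  ultimately show ?case
    using insert.prems by auto
qed

text \<open>
  Each vector lies in the span of one of the countably many finite subsets of \<open>B\<close>, and each of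
  these spans contains only finitely many elements of \<open>S\<close>.
\<close>

lemma (in vector_space) countable_independent:
  assumes "countable B" and "span B = UNIV" and "independent S"
  shows "countable S"
proof -
  have "S \<subseteq> (\<Union>T\<in>{T. T \<subseteq> B \<and> finite T}. S \<inter> span T)"
  proof
    fix x assume "x \<in> S"
    have "x \<in> span B"
      using assms(2) by simp
    then obtain T c where "finite T" "T \<subseteq> B" "x = (\<Sum>a\<in>T. scale (c a) a)"
      unfolding span_explicit by auto
    then have "x \<in> span T"
      by (auto intro: span_sum span_scale span_base)
    then show "x \<in> (\<Union>T\<in>{T. T \<subseteq> B \<and> finite T}. S \<inter> span T)"
      using \<open>finite T\<close> \<open>T \<subseteq> B\<close> \<open>x \<in> S\<close> by auto
  qed
  moreover have "finite (S \<inter> span T)" if "finite T" for T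
    using independent_span_bound[OF that, of "S \<inter> span T"] assms(3) independent_mono by blast
  then have "countable (\<Union>T\<in>{T. T \<subseteq> B \<and> finite T}. S \<inter> span T)"
    using countable_Collect_finite_subset[OF assms(1)]
    by (intro countable_UN) (auto simp: conj_commute intro: countable_finite)
  ultimately show ?thesis
    by (rule countable_subset)
qed

lemma (in vector_space) countable_eigenvalues:
  assumes "countable B" and "span B = UNIV"
    and add: "\<And>x y. T (x + y) = T x + T y"
    and scale: "\<And>c x. T (scale c x) = scale c (T x)"
  shows "countable {ev. \<exists>v. v \<noteq> 0 \<and> T v = scale ev v}" (is "countable ?L")
proof -
  define v where "v ev = (SOME v. v \<noteq> 0 \<and> T v = scale ev v)" for ev
  have v: "v ev \<noteq> 0 \<and> T (v ev) = scale ev (v ev)" if "ev \<in> ?L" for ev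
    unfolding v_def by (rule someI_ex) (use that in simp)
  have inj: "inj_on v ?L"
  proof
    fix a b assume "a \<in> ?L" "b \<in> ?L" "v a = v b"
    then have "scale a (v a) = scale b (v a)" "v a \<noteq> 0"
      using v by metis+
    then show "a = b"
      by simp
  qed
  have "independent (v ` ?L)"
    unfolding independent_explicit_module
  proof (intro allI impI)
    fix t u x assume t: "finite t" "t \<subseteq> v ` ?L" "(\<Sum>x\<in>t. scale (u x) x) = 0" "x \<in> t"
    define ev where "ev = the_inv_into ?L v"
    have ev: "x \<noteq> 0" "T x = scale (ev x) x" if "x \<in> t" for x
    proof -
      have "x \<in> v ` ?L"
        using t(2) that by (rule subsetD)
      then obtain l where l: "x = v l" "l \<in> ?L"
        by (rule imageE)
      have "ev x = l"
        unfolding l(1) ev_def using inj l(2) by (rule the_inv_into_f_f)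
      then show "x \<noteq> 0" "T x = scale (ev x) x"
        using v[OF l(2)] by (simp_all add: l(1))
    qed
    have "inj_on ev t"
      unfolding ev_def by (rule inj_on_subset[OF inj_on_the_inv_into[OF inj] t(2)])
    moreover have "T (scale (u x) x) = scale (ev x) (scale (u x) x)" if "x \<in> t" for x
      by (simp only: scale ev(2)[OF that] scale_left_commute)
    ultimately have "scale (u x) x = 0"
      using t by (intro eigenvectors_sum_zero[of t ev T "\<lambda>x. scale (u x) x" x] add scale) simp_all
    then show "u x = 0"
      using ev t(4) by simp
  qed
  then have "countable (v ` ?L)"
    by (rule countable_independent[OF assms(1,2)])
  then show ?thesis
    using inj by (rule countable_image_inj_on)
qed

section \<open>The ring as an algebra spanned by monomials\<close>

definition monomial :: "('n::finite \<Rightarrow>\<^sub>0 nat) \<Rightarrow> 'n fermat2" where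
  "monomial a = abs_fermat2 (Poly_Mapping.single a 1)"

lemma fermat_rel_refl [simp]: "fermat_rel p p"
  by (simp add: fermat_rel_def)

lemma cst_0 [simp]: "cst 0 = 0"
  by transfer (simp add: pconst_def)

lemma cst_1 [simp]: "cst 1 = 1"
  by transfer (simp add: pconst_def)

lemma cst_add: "cst (a + b) = cst a + cst b"
  by transfer (simp add: pconst_def single_add)

lemma cst_mult: "cst (a * b) = cst a * cst b"
  by transfer (simp add: pconst_def mult_single)

lemma cst_minus: "cst (- a) = - cst a"
  using cst_add[of a "- a"] by (simp add: eq_neg_iff_add_eq_0 add.commute)

interpretation fermat2: vector_space "\<lambda>c (r :: 'n::finite fermat2). cst c * r"
  by unfold_locales (simp_all add: distrib_left distrib_right cst_add cst_mult mult.assoc)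

lemma monomial_0 [simp]: "monomial 0 = 1"
  by (simp add: monomial_def one_fermat2.abs_eq)

lemma monomial_add: "monomial (a + b) = monomial a * monomial b"
  by (simp add: monomial_def times_fermat2.abs_eq mult_single)

lemma monomial_single: "monomial (Poly_Mapping.single i k) = xvar i ^ k"
proof (induction k)
  case (Suc k)
  have "monomial (Poly_Mapping.single i (Suc k))
      = monomial (Poly_Mapping.single i 1) * monomial (Poly_Mapping.single i k)"
    by (simp flip: monomial_add single_add)
  moreover have "monomial (Poly_Mapping.single i 1) = xvar i"
    by (simp add: monomial_def xvar.abs_eq pvar_def)
  ultimately show ?case
    using Suc by simp
qed simp

lemma monomial_eq_prod: "monomial a = (\<Prod>i\<in>UNIV. xvar i ^ Poly_Mapping.lookup a i)"
proof -
  have "monomial (\<Sum>i\<in>I. Poly_Mapping.single i (Poly_Mapping.lookup a i))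
      = (\<Prod>i\<in>I. xvar i ^ Poly_Mapping.lookup a i)" for I
    by (induction I rule: infinite_finite_induct)
      (simp_all add: monomial_add monomial_single)
  moreover have "(\<Sum>i\<in>UNIV. Poly_Mapping.single i (Poly_Mapping.lookup a i)) = a"
    by (rule poly_mapping_eqI) (simp add: lookup_sum lookup_single when_def)
  ultimately show ?thesis
    by metis
qed

lemma cpoly_induct [case_names single add]:
  fixes p :: "'n cpoly"
  assumes single: "\<And>c a. P (Poly_Mapping.single a c)"
    and add: "\<And>p q. P p \<Longrightarrow> P q \<Longrightarrow> P (p + q)"
  shows "P p"
proof (induction p rule: update_induct)
  case const
  show ?case using single[of 0 0] by simp
next
  case (update p a c)
  then have "Poly_Mapping.update a c p = p + Poly_Mapping.single a c"
    by (intro poly_mapping_eqI) (auto simp: lookup_update lookup_add lookup_single in_keys_iff)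
  then show ?case
    using add[OF update(3) single] by simp
qed

lemma fermat2_induct_single [case_names single add]:
  assumes single: "\<And>c a. P (cst c * monomial a)"
    and add: "\<And>r s. P r \<Longrightarrow> P s \<Longrightarrow> P (r + s)"
  shows "P r"
proof -
  have "P (abs_fermat2 p)" for p
  proof (induction p rule: cpoly_induct)
    case (single c a)
    have "abs_fermat2 (Poly_Mapping.single a c) = cst c * monomial a"
      by (simp add: cst.abs_eq monomial_def times_fermat2.abs_eq pconst_def mult_single)
    then show ?case
      using assms(1) by simp
  next
    case (add p q)
    then show ?case
      using assms(2)[of "abs_fermat2 p" "abs_fermat2 q"] by (simp add: plus_fermat2.abs_eq)
  qed
  then show ?thesis
    by (induction r rule: fermat2.abs_induct) simp
qed

lemma fermat2_induct_var [case_names cst xvar add mult]: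
  assumes cst: "\<And>c. P (cst c)"
    and xvar: "\<And>i. P (xvar i)"
    and add: "\<And>r s. P r \<Longrightarrow> P s \<Longrightarrow> P (r + s)"
    and mult: "\<And>r s. P r \<Longrightarrow> P s \<Longrightarrow> P (r * s)"
  shows "P r"
proof (induction r rule: fermat2_induct_single)
  case (single c a)
  have one: "P 1"
    using cst[of 1] by simp
  have "P (xvar i ^ k)" for i k
    by (induction k) (simp_all add: one xvar mult)
  then have "P (\<Prod>i\<in>I. xvar i ^ Poly_Mapping.lookup a i)" for I
    by (induction I rule: infinite_finite_induct) (simp_all add: one mult)
  then show ?case
    by (simp add: monomial_eq_prod cst mult)
qed (rule add)

lemma countable_range_monomial: "countable (range (monomial :: ('n::finite \<Rightarrow>\<^sub>0 nat) \<Rightarrow> _))"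
proof -
  have "inj (Poly_Mapping.lookup :: ('n \<Rightarrow>\<^sub>0 nat) \<Rightarrow> _)"
    by (simp add: inj_def)
  then have "countable (UNIV :: ('n \<Rightarrow>\<^sub>0 nat) set)"
    using countableI_type by (rule countable_image_inj_on[rotated])
  then show ?thesis
    by simp
qed

lemma span_monomials: "fermat2.span (range monomial) = UNIV"
proof -
  have "r \<in> fermat2.span (range monomial)" for r :: "'n::finite fermat2"
    by (induction r rule: fermat2_induct_single)
      (auto intro: fermat2.span_add fermat2.span_scale fermat2.span_base)
  then show ?thesis
    by auto
qed

section \<open>Derivations\<close>

lemma derivationD:
  assumes "derivation d"
  shows "d (a + b) = d a + d b" and "d (cst c * a) = cst c * d a" and "d (a * b) = d a * b + a * d b"
  using assms unfolding derivation_def by blast+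

lemma derivation_0: "derivation d \<Longrightarrow> d 0 = 0"
  using derivationD(2)[of d 0 0] by simp

lemma derivation_cst:
  assumes "derivation d"
  shows "d (cst c) = 0"
proof -
  have "d 1 = d 1 + d 1"
    using derivationD(3)[OF assms, of 1 1] by simp
  then show ?thesis
    using derivationD(2)[OF assms, of c 1] by simp
qed

lemma derivation_sum:
  assumes "derivation d"
  shows "d (sum f I) = (\<Sum>i\<in>I. d (f i))"
  by (induction I rule: infinite_finite_induct)
    (simp_all add: derivationD[OF assms] derivation_0[OF assms])

lemma derivation_eq_0:
  assumes "derivation d" and "\<And>i. d (xvar i) = 0"
  shows "d r = 0"
  by (induction r rule: fermat2_induct_var)
    (simp_all add: derivationD[OF assms(1)] derivation_cst[OF assms(1)] assms(2))

lemma derivation_commutator: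
  assumes "derivation d" and "derivation e"
  shows "derivation (\<lambda>r. d (e r) - e (d r))"
  unfolding derivation_def
  by (simp add: derivationD[OF assms(1)] derivationD[OF assms(2)] derivation_cst[OF assms(1)]
      derivation_cst[OF assms(2)] derivation_0[OF assms(1)] derivation_0[OF assms(2)] algebra_simps)

section \<open>The Euler derivation and the grading\<close>

definition total_degree :: "('n::finite \<Rightarrow>\<^sub>0 nat) \<Rightarrow> nat" where
  "total_degree a = (\<Sum>i\<in>UNIV. Poly_Mapping.lookup a i)"

lemma total_degree_add: "total_degree (a + b) = total_degree a + total_degree b"
  by (simp add: total_degree_def lookup_add sum.distrib)

lemma total_degree_single [simp]: "total_degree (Poly_Mapping.single i k) = k"
  by (simp add: total_degree_def lookup_single when_def)

lemma total_degree_eq_0_iff: "total_degree a = 0 \<longleftrightarrow> a = 0"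
  by (auto simp: total_degree_def poly_mapping_eq_iff fun_eq_iff)

definition euler_poly :: "'n::finite cpoly \<Rightarrow> 'n cpoly" where
  "euler_poly = Poly_Mapping.mapp (\<lambda>a c. of_nat (total_degree a) * c)"

lemma lookup_euler_poly:
  "Poly_Mapping.lookup (euler_poly p) a = of_nat (total_degree a) * Poly_Mapping.lookup p a"
  by (simp add: euler_poly_def lookup_mapp when_def in_keys_iff)

lemma euler_poly_add: "euler_poly (p + q) = euler_poly p + euler_poly q"
  by (rule poly_mapping_eqI) (simp add: lookup_euler_poly lookup_add distrib_left)

lemma euler_poly_diff: "euler_poly (p - q) = euler_poly p - euler_poly q"
  by (rule poly_mapping_eqI) (simp add: lookup_euler_poly lookup_minus right_diff_distrib)

lemma euler_poly_single:
  "euler_poly (Poly_Mapping.single a c) = Poly_Mapping.single a (of_nat (total_degree a) * c)"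
  by (rule poly_mapping_eqI) (simp add: lookup_euler_poly lookup_single when_def)

lemma euler_poly_mult: "euler_poly (p * q) = euler_poly p * q + p * euler_poly q"
proof (induction p rule: cpoly_induct)
  case (single c a)
  show ?case
  proof (induction q rule: cpoly_induct)
    case (single d b)
    have "of_nat (total_degree (a + b)) * (c * d)
        = of_nat (total_degree a) * c * d + c * (of_nat (total_degree b) * d)"
      by (simp add: total_degree_add algebra_simps)
    then show ?case
      by (simp only: euler_poly_single mult_single flip: single_add)
  next
    case (add p q)
    then show ?case
      by (simp add: distrib_left euler_poly_add)
  qed
next
  case (add p q)
  then show ?case
    by (simp add: distrib_right euler_poly_add)
qed

text \<open>Homogeneity of the relation, which makes the Euler derivation descend to the quotient.\<close>

lemma euler_poly_sum_squares: "euler_poly sum_squares = sum_squares + sum_squares"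
proof -
  have "euler_poly (\<Sum>i\<in>I. pvar i ^ 2) = (\<Sum>i\<in>I. pvar i ^ 2) + (\<Sum>i\<in>I. pvar i ^ 2)"
    for I :: "'n::finite set"
  proof (induction I rule: infinite_finite_induct)
    case (insert i I)
    have "euler_poly (pvar i ^ 2) = pvar i ^ 2 + pvar i ^ 2"
      by (simp add: power2_eq_square euler_poly_mult) (simp add: pvar_def euler_poly_single)
    with insert show ?case
      by (simp add: euler_poly_add)
  qed (simp_all add: poly_mapping_eq_iff fun_eq_iff lookup_euler_poly)
  then show ?thesis
    unfolding sum_squares_def .
qed

lift_definition euler :: "'n::finite fermat2 \<Rightarrow> 'n fermat2" is euler_poly
proof -
  fix p q :: "'n cpoly"
  assume "fermat_rel p q"
  then obtain k where k: "p - q = sum_squares * k"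
    by (auto simp: fermat_rel_def)
  have "euler_poly p - euler_poly q = sum_squares * (k + k + euler_poly k)"
    by (simp add: k euler_poly_mult euler_poly_sum_squares distrib_left distrib_right
        flip: euler_poly_diff)
  then show "fermat_rel (euler_poly p) (euler_poly q)"
    by (simp add: fermat_rel_def)
qed

lemma derivation_euler: "derivation (euler :: 'n::finite fermat2 \<Rightarrow> _)"
  unfolding derivation_def
proof (intro conjI allI)
  fix a b :: "'n fermat2"
  show "euler (a + b) = euler a + euler b"
    by transfer (simp add: euler_poly_add)
  show *: "euler (a * b) = euler a * b + a * euler b" for a b :: "'n fermat2"
    by transfer (simp add: euler_poly_mult)
  fix c
  have "euler (cst c) = (0 :: 'n fermat2)"
    by transfer (simp add: pconst_def euler_poly_single total_degree_def)
  then show "euler (cst c * a) = cst c * euler a"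
    by (simp add: *)
qed

lemma euler_monomial: "euler (monomial a) = cst (of_nat (total_degree a)) * monomial a"
  by (simp add: monomial_def euler.abs_eq cst.abs_eq times_fermat2.abs_eq euler_poly_single
      pconst_def mult_single del: single_of_nat)

lemma euler_xvar: "euler (xvar i) = xvar i"
  by transfer (simp add: pvar_def euler_poly_single)

text \<open>
  Asking for the sum over \<open>{..M}\<close> for all large \<open>M\<close> lets decompositions of different lengths be
  added termwise.
\<close>

lemma homogeneous_decomposition:
  "\<exists>f N. (\<forall>m. euler (f m) = cst (of_nat m) * f m) \<and> f 0 \<in> range cst \<and>
     (\<forall>M\<ge>N. r = (\<Sum>m\<le>M. f m))"
proof (induction r rule: fermat2_induct_single)
  case (single c a)
  define f where "f m = (if m = total_degree a then cst c * monomial a else 0)" for m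
  have "euler (f m) = cst (of_nat m) * f m" for m
    by (simp add: f_def derivationD(2)[OF derivation_euler] euler_monomial
        derivation_0[OF derivation_euler] mult_ac)
  moreover have "f 0 \<in> range cst"
  proof (cases "total_degree a = 0")
    case True
    then show ?thesis
      by (simp add: f_def total_degree_eq_0_iff)
  next
    case False
    then show ?thesis
      by (intro image_eqI[where x = 0]) (simp_all add: f_def)
  qed
  moreover have "cst c * monomial a = (\<Sum>m\<le>M. f m)" if "M \<ge> total_degree a" for M
    using that by (simp add: f_def)
  ultimately show ?case
    by blast
next
  case (add r s)
  then obtain f N g K where
    f: "\<And>m. euler (f m) = cst (of_nat m) * f m" "f 0 \<in> range cst" "\<And>M. M \<ge> N \<Longrightarrow> r = (\<Sum>m\<le>M. f m)" and
    g: "\<And>m. euler (g m) = cst (of_nat m) * g m" "g 0 \<in> range cst" "\<And>M. M \<ge> K \<Longrightarrow> s = (\<Sum>m\<le>M. g m)"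
    by blast
  have "f 0 + g 0 \<in> range cst"
    using f(2) g(2) by (auto simp flip: cst_add)
  moreover have "r + s = (\<Sum>m\<le>M. f m + g m)" if "M \<ge> max N K" for M
    using that f(3)[of M] g(3)[of M] by (simp add: sum.distrib)
  moreover have "euler (f m + g m) = cst (of_nat m) * (f m + g m)" for m
    by (simp add: derivationD(1)[OF derivation_euler] f(1) g(1) distrib_left)
  ultimately show ?case
    by (intro exI[where x = "\<lambda>m. f m + g m"] exI[where x = "max N K"]) simp
qed

text \<open>
  Both sides agree on the \<open>x\<^sub>i\<close>, because \<open>E\<close> is the identity on linear forms; the commutator, being
  a derivation, then vanishes everywhere.  So \<open>d\<close> preserves the degree of forms.
\<close>

lemma euler_linear_derivation_commute:
  assumes "linear_derivation d"
  shows "euler (d r) = d (euler r)"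
proof -
  have d: "derivation d"
    using assms by (simp add: linear_derivation_def)
  obtain A where A: "associated_matrix d A"
    using assms by (auto simp: linear_derivation_def)
  have "euler (d (xvar i)) - d (euler (xvar i)) = 0" for i
    using A by (simp add: associated_matrix_def euler_xvar derivation_sum[OF derivation_euler]
        derivationD(2)[OF derivation_euler])
  then show ?thesis
    using derivation_eq_0[OF derivation_commutator[OF derivation_euler d]] by simp
qed

lemma scalar_derivation_euler: "scalar_derivation (\<lambda>r. cst \<alpha> * euler r)"
proof -
  have "associated_matrix (\<lambda>r. cst \<alpha> * euler r) (mat \<alpha>)"
    by (simp add: associated_matrix_def mat_def euler_xvar if_distrib[of cst]
        if_distrib[of "\<lambda>x. x * _"] cong: if_cong)
  moreover have "derivation (\<lambda>r. cst \<alpha> * euler r)"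
    unfolding derivation_def by (simp add: derivationD[OF derivation_euler] derivation_cst[OF derivation_euler]
        algebra_simps)
  ultimately show ?thesis
    unfolding scalar_derivation_def linear_derivation_def by blast
qed

section \<open>Perturbing a linear derivation by a scalar derivation\<close>

text \<open>
  The hypothesis says that \<open>\<alpha>m + d\<close>, which is the restriction of \<open>\<alpha>E + d\<close> to the forms of degree
  \<open>m\<close>, is injective for \<open>m > 0\<close>.
\<close>

lemma constants_euler_add_linear_derivation:
  fixes d :: "'n::finite fermat2 \<Rightarrow> 'n fermat2"
  assumes d_lin: "linear_derivation d"
    and no_eigen: "\<And>m v. m > 0 \<Longrightarrow> d v = cst (- (of_nat m * \<alpha>)) * v \<Longrightarrow> v = 0"
  shows "ring_of_constants (\<lambda>r. cst \<alpha> * euler r + d r) = range cst"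
proof (rule set_eqI)
  have d: "derivation d"
    using d_lin by (simp add: linear_derivation_def)
  fix r :: "'n fermat2"
  obtain f N where
    f: "\<And>m. euler (f m) = cst (of_nat m) * f m" "f 0 \<in> range cst" "r = (\<Sum>m\<le>N. f m)"
    using homogeneous_decomposition[of r] by blast
  show "r \<in> ring_of_constants (\<lambda>r. cst \<alpha> * euler r + d r) \<longleftrightarrow> r \<in> range cst"
  proof
    assume "r \<in> ring_of_constants (\<lambda>r. cst \<alpha> * euler r + d r)"
    then have "(\<Sum>m\<le>N. cst \<alpha> * euler (f m) + d (f m)) = 0"
      by (simp add: ring_of_constants_def f(3) derivation_sum[OF derivation_euler]
          derivation_sum[OF d] sum.distrib sum_distrib_left)
    \<comment> \<open>The summands are forms of distinct degrees, so each of them vanishes.\<close>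
    moreover have "euler (cst \<alpha> * euler (f m) + d (f m))
        = cst (of_nat m) * (cst \<alpha> * euler (f m) + d (f m))" for m
      unfolding derivationD(1,2)[OF derivation_euler] euler_linear_derivation_commute[OF d_lin] f(1)
        derivationD(2)[OF d]
      by (simp add: algebra_simps)
    ultimately have zero: "cst \<alpha> * euler (f m) + d (f m) = 0" if "m \<le> N" for m
      using that derivationD(1,2)[OF derivation_euler]
      by (intro fermat2.eigenvectors_sum_zero[of "{..N}" of_nat euler
            "\<lambda>m. cst \<alpha> * euler (f m) + d (f m)"])
        (simp_all add: inj_on_def)
    have "f m = 0" if "m \<le> N" "m > 0" for m
    proof (rule no_eigen)
      have "d (f m) = - (cst \<alpha> * (cst (of_nat m) * f m))"
        using zero[OF that(1)] by (simp add: f(1) add_eq_0_iff)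
      also have "\<dots> = cst (- (of_nat m * \<alpha>)) * f m"
        by (simp add: cst_minus cst_mult mult_ac)
      finally show "d (f m) = cst (- (of_nat m * \<alpha>)) * f m" .
    qed (fact that)
    then have "r = f 0"
      unfolding f(3) by (subst sum.remove[of _ 0]) auto
    then show "r \<in> range cst"
      using f(2) by simp
  next
    assume "r \<in> range cst"
    then show "r \<in> ring_of_constants (\<lambda>r. cst \<alpha> * euler r + d r)"
      by (auto simp: ring_of_constants_def derivation_cst[OF d] derivation_cst[OF derivation_euler])
  qed
qed

theorem theorem18:
  fixes d\<^sub>s :: "'n::finite fermat2 \<Rightarrow> 'n fermat2"
  assumes "CARD('n) \<ge> 3"
    and "skew_symmetric_derivation d\<^sub>s"
    and "d\<^sub>s \<noteq> (\<lambda>_. 0)"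
  shows "\<exists>d\<^sub>\<alpha> :: 'n fermat2 \<Rightarrow> 'n fermat2. scalar_derivation d\<^sub>\<alpha> \<and>
           ring_of_constants (\<lambda>r. d\<^sub>\<alpha> r + d\<^sub>s r) = range cst"
proof -
  have lin: "linear_derivation d\<^sub>s" and d: "derivation d\<^sub>s"
    using assms(2) by (simp_all add: skew_symmetric_derivation_def linear_derivation_def)
  define L where "L = {ev. \<exists>v. v \<noteq> 0 \<and> d\<^sub>s v = cst ev * v}"
  have "countable L"
    unfolding L_def by (rule fermat2.countable_eigenvalues[OF countable_range_monomial span_monomials])
      (rule derivationD(1,2)[OF d])+
  \<comment> \<open>Dividing by \<open>of_nat 0 = 0\<close> puts at most the number \<open>0\<close> into this set.\<close>
  then have "countable (\<Union>m::nat. (\<lambda>ev. - ev / of_nat m) ` L)"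
    by simp
  then obtain \<alpha> :: complex where \<alpha>: "\<alpha> \<notin> (\<Union>m::nat. (\<lambda>ev. - ev / of_nat m) ` L)"
    using uncountable_UNIV_complex by (metis UNIV_eq_I)
  have "v = 0" if "m > 0" "d\<^sub>s v = cst (- (of_nat m * \<alpha>)) * v" for m v
  proof (rule ccontr)
    assume "v \<noteq> 0"
    then have "- (of_nat m * \<alpha>) \<in> L"
      using that by (auto simp: L_def)
    moreover have "\<alpha> = - (- (of_nat m * \<alpha>)) / of_nat m"
      using that(1) by simp
    ultimately show False
      using \<alpha> by blast
  qed
  then have "ring_of_constants (\<lambda>r. cst \<alpha> * euler r + d\<^sub>s r) = range cst"
    by (rule constants_euler_add_linear_derivation[OF lin])
  then show ?thesis
    using scalar_derivation_euler by blast
qed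

end
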